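(* The $i$-Catalan monoid $IC_4$ is not contained in any finitely based variety generated by a finite $\mathcal{R}$-trivial semigroup. That is, if $S$ is a finite $\mathcal{R}$-trivial semigroup and $IC_4\in\operatorname{var}S$, then the variety $\operatorname{var}S$ is not finitely based.
   Context: For a positive integer $m$, let $[m]=\{1<2<\dots<m\}$. A partial transformation of $[m]$ is a map $\alpha$ from a subset $\operatorname{dom}\alpha\subseteq[m]$ (possibly empty) to $[m]$; maps are written on the right of their arguments and composed left to right. It is order preserving if $i\le j$ implies $i\alpha\le j\alpha$ for all $i,j\in\operatorname{dom}\alpha$, and extensive if $i\le i\alpha$ for all $i\in\operatorname{dom}\alpha$. The $i$-Catalan monoid $IC_m$ is the monoid (under composition) of all partial injections of $[m]$ that are extensive and order preserving. A semigroup $S$ is $\mathcal{R}$-trivial if for all $a,b\in S$, $aS\cup\{a\}=bS\cup\{b\}$ implies $a=b$. A semigroup identity $\mathbf{w}\bumpeq\mathbf{w}'$ is a pair of nonempty words in variables (from a countably infinite set); a semigroup $S$ satisfies it if $\varphi(\mathbf{w})=\varphi(\mathbf{w}')$ for every substitution $\varphi$ of elements of $S$ for the variables. A variety is the class of all semigroups satisfying all identities of some given set; it is finitely based if it can be defined by a finite set of identities. $\operatorname{var}S$, the variety generated by $S$, is the class of all semigroups satisfying every identity that $S$ satisfies. *)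

theory Defs
  imports "HOL-Algebra.Congruence"
begin

section \<open>Semigroups with explicit carrier\<close>

record 'a magma = "'a partial_object" +
  mul :: "'a \<Rightarrow> 'a \<Rightarrow> 'a" (infixl \<open>\<cdot>\<index>\<close> 70)

definition is_semigroup :: "'a magma \<Rightarrow> bool" where
  "is_semigroup S \<longleftrightarrow>
     carrier S \<noteq> {} \<and>
     (\<forall>a\<in>carrier S. \<forall>b\<in>carrier S. a \<cdot>\<^bsub>S\<^esub> b \<in> carrier S) \<and>
     (\<forall>a\<in>carrier S. \<forall>b\<in>carrier S. \<forall>c\<in>carrier S.
        (a \<cdot>\<^bsub>S\<^esub> b) \<cdot>\<^bsub>S\<^esub> c = a \<cdot>\<^bsub>S\<^esub> (b \<cdot>\<^bsub>S\<^esub> c))"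

definition R_trivial :: "'a magma \<Rightarrow> bool" where
  "R_trivial S \<longleftrightarrow>
     (\<forall>a\<in>carrier S. \<forall>b\<in>carrier S.
        (\<lambda>s. a \<cdot>\<^bsub>S\<^esub> s) ` carrier S \<union> {a} = (\<lambda>s. b \<cdot>\<^bsub>S\<^esub> s) ` carrier S \<union> {b} \<longrightarrow> a = b)"


section \<open>Identities and varieties\<close>

text \<open>Variables are natural numbers and words are lists of variables. Only nonempty words
  occur in identities.\<close>

type_synonym identity = "nat list \<times> nat list"

definition identities :: "identity set" where
  "identities = {(u, v). u \<noteq> [] \<and> v \<noteq> []}"

text \<open>The value of a word under a substitution. The value of the empty word is unspecified and
  never used.\<close>

fun word_value :: "'a magma \<Rightarrow> (nat \<Rightarrow> 'a) \<Rightarrow> nat list \<Rightarrow> 'a" where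
  "word_value S \<phi> [x] = \<phi> x"
| "word_value S \<phi> (x # y # w) = \<phi> x \<cdot>\<^bsub>S\<^esub> word_value S \<phi> (y # w)"

definition satisfies :: "'a magma \<Rightarrow> identity \<Rightarrow> bool" where
  "satisfies S e \<longleftrightarrow>
     (\<forall>\<phi>. (\<forall>x. \<phi> x \<in> carrier S) \<longrightarrow> word_value S \<phi> (fst e) = word_value S \<phi> (snd e))"

text \<open>A HOL set contains only semigroups with elements in one type, so the class of all
  semigroups satisfying \<open>\<Sigma>\<close> is represented by one set for each type \<open>'a\<close>.\<close>

definition variety :: "identity set \<Rightarrow> 'a magma set" where
  "variety \<Sigma> = {T. is_semigroup T \<and> (\<forall>e\<in>\<Sigma>. satisfies T e)}"

text \<open>The variety generated by \<open>S\<close>. Its members may live in a type different from that of \<open>S\<close>.\<close>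

definition var :: "'b magma \<Rightarrow> 'a magma set" where
  "var S = variety {e \<in> identities. satisfies S e}"

text \<open>This agrees with the notion for classes of semigroups of arbitrary size as soon as \<open>'a\<close>
  is infinite: an identity involves finitely many variables, so a semigroup satisfies it iff all its
  countable subsemigroups do, and every countable semigroup has an isomorphic copy in an infinite
  type. Over a finite \<open>'a\<close> the notion is not meaningful.\<close>

definition finitely_based :: "'a magma set \<Rightarrow> bool" where
  "finitely_based V \<longleftrightarrow> (\<exists>\<Sigma> \<subseteq> identities. finite \<Sigma> \<and> V = variety \<Sigma>)"


section \<open>The \<open>i\<close>-Catalan monoid\<close>

text \<open>Maps act on the right and compose left to right, so the product of \<open>\<alpha>\<close> and \<open>\<beta>\<close> applies
  \<open>\<alpha>\<close> first.\<close>

definition IC :: "nat \<Rightarrow> (nat \<rightharpoonup> nat) magma" where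
  "IC m = \<lparr> carrier =
       {\<alpha>. dom \<alpha> \<subseteq> {1..m} \<and> ran \<alpha> \<subseteq> {1..m} \<and> inj_on \<alpha> (dom \<alpha>) \<and>
           (\<forall>i\<in>dom \<alpha>. \<forall>j\<in>dom \<alpha>. i \<le> j \<longrightarrow> the (\<alpha> i) \<le> the (\<alpha> j)) \<and>
           (\<forall>i\<in>dom \<alpha>. i \<le> the (\<alpha> i))},
     mul = (\<lambda>\<alpha> \<beta>. \<beta> \<circ>\<^sub>m \<alpha>) \<rparr>"

end

theory Submission
  imports Defs "HOL-Library.Sublist" "HOL-Computational_Algebra.Primes"
begin

text \<open>Reading a word in a finite \<open>\<R>\<close>-trivial semigroup from left to right, the prefix values descend
  strictly whenever they change. After more than \<open>|S|\<close> blocks with the same content \<open>C\<close> the value is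
  therefore fixed by all letters of \<open>C\<close>, and a further letter of \<open>C\<close> may be dropped: \<open>S\<close> satisfies
  \<open>U \<approx> V\<close>, where \<open>V\<close> is \<open>U\<close> without its last letter.

  The blocks are chosen such that every pair of adjacent letters occurs once in \<open>U\<close> and the letters
  in every window of length \<open>n\<close> are distinct. If \<open>u\<close> has fewer than \<open>n\<close> variables and some substitution
  maps \<open>u\<close> onto a factor of \<open>U\<close>, then any two occurrences of a variable in \<open>u\<close> are separated by a
  variable occurring only once. For such \<open>u\<close>, paths \<open>1 \<rightarrow> 2 \<rightarrow> 3 \<rightarrow> 4\<close> in \<open>IC\<^sub>4\<close> that move at such
  a variable, at one letter up to the next such variable, and at the latter recover \<open>u\<close>, so \<open>IC\<^sub>4\<close>
  satisfies no \<open>u \<approx> v\<close> with \<open>v \<noteq> u\<close>. Hence the Rees quotient of the free semigroup by the non-factors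
  of \<open>U\<close> satisfies all identities of \<open>IC\<^sub>4\<close> in fewer than \<open>n\<close> variables but not \<open>U \<approx> V\<close>.\<close>

section \<open>Values of words\<close>

lemma word_value_Cons:
  "w \<noteq> [] \<Longrightarrow> word_value S \<phi> (x # w) = \<phi> x \<cdot>\<^bsub>S\<^esub> word_value S \<phi> w"
  by (cases w) auto

lemma semigroup_closed:
  "is_semigroup S \<Longrightarrow> a \<in> carrier S \<Longrightarrow> b \<in> carrier S \<Longrightarrow> a \<cdot>\<^bsub>S\<^esub> b \<in> carrier S"
  by (auto simp: is_semigroup_def)

lemma semigroup_assoc:
  "is_semigroup S \<Longrightarrow> a \<in> carrier S \<Longrightarrow> b \<in> carrier S \<Longrightarrow> c \<in> carrier S \<Longrightarrow>
    (a \<cdot>\<^bsub>S\<^esub> b) \<cdot>\<^bsub>S\<^esub> c = a \<cdot>\<^bsub>S\<^esub> (b \<cdot>\<^bsub>S\<^esub> c)"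
  by (auto simp: is_semigroup_def)

lemma word_value_closed:
  assumes "is_semigroup S" "\<And>x. x \<in> set w \<Longrightarrow> \<phi> x \<in> carrier S" "w \<noteq> []"
  shows "word_value S \<phi> w \<in> carrier S"
  using assms(2,3)
proof (induction w)
  case (Cons x w)
  then show ?case
    by (cases "w = []") (auto simp: word_value_Cons intro: semigroup_closed[OF assms(1)])
qed simp

lemma word_value_append:
  assumes "is_semigroup S" "\<And>x. \<phi> x \<in> carrier S" "u \<noteq> []" "v \<noteq> []"
  shows "word_value S \<phi> (u @ v) = word_value S \<phi> u \<cdot>\<^bsub>S\<^esub> word_value S \<phi> v"
  using assms(3)
proof (induction u)
  case (Cons x u)
  show ?case
  proof (cases "u = []")
    case True
    then show ?thesis using assms(4) by (simp add: word_value_Cons)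
  next
    case False
    have "word_value S \<phi> u \<in> carrier S" "word_value S \<phi> v \<in> carrier S"
      using word_value_closed assms False by blast+
    then show ?thesis
      using Cons.IH False assms(1,2) by (simp add: word_value_Cons semigroup_assoc)
  qed
qed simp

lemma satisfies_context:
  assumes "is_semigroup S" "satisfies S (u, v)" "u \<noteq> []" "v \<noteq> []" "a \<noteq> []" "b \<noteq> []"
  shows "satisfies S (a @ u @ b, a @ v @ b)"
  using assms unfolding satisfies_def by (simp add: word_value_append)

text \<open>\<open>var S\<close> at type \<open>'a\<close> has only semigroups on \<open>'a\<close>
  as members. A bijection onto a finite subset of \<open>'a\<close> brings \<open>IC 4\<close> and
  the factor semigroups there.\<close>

lemma finite_semigroup_copy:
  fixes T :: "'c magma"
  assumes T: "is_semigroup T" and fin: "finite (carrier T)" and inf: "infinite (UNIV :: 'a set)"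
  obtains T' :: "'a magma" where "is_semigroup T'"
    "\<And>e. e \<in> identities \<Longrightarrow> satisfies T' e \<longleftrightarrow> satisfies T e"
proof -
  obtain B :: "'a set" where B: "card B = card (carrier T)" "finite B"
    using infinite_arbitrarily_large[OF inf] by blast
  obtain g where g: "bij_betw g (carrier T) B"
    using finite_same_card_bij[OF fin B(2)] B(1) by auto
  define h where "h = inv_into (carrier T) g"
  have hg: "h (g a) = a" if "a \<in> carrier T" for a
    using g that by (simp add: h_def bij_betw_def inv_into_f_f)
  define T' :: "'a magma" where
    "T' = \<lparr>carrier = g ` carrier T, mul = (\<lambda>a b. g (h a \<cdot>\<^bsub>T\<^esub> h b))\<rparr>"
  have sg: "is_semigroup T'"
    using T unfolding T'_def is_semigroup_def by (auto simp: hg)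
  have val: "word_value T' \<phi> w = g (word_value T (h \<circ> \<phi>) w)"
    if "\<And>x. \<phi> x \<in> carrier T'" "w \<noteq> []" for \<phi> w
    using that(2)
  proof (induction w)
    case (Cons x w)
    have gh: "g (h a) = a" "h a \<in> carrier T" if "a \<in> carrier T'" for a
      using that hg by (auto simp: T'_def)
    show ?case
    proof (cases "w = []")
      case True
      then show ?thesis using gh that(1) by simp
    next
      case False
      have "word_value T (h \<circ> \<phi>) w \<in> carrier T"
        using word_value_closed[OF T, of w "h \<circ> \<phi>"] False gh that(1) by simp
      moreover have "word_value T' \<phi> (x # w) = g (h (\<phi> x) \<cdot>\<^bsub>T\<^esub> h (word_value T' \<phi> w))"
        using False by (simp add: word_value_Cons T'_def)
      ultimately show ?thesis
        using Cons.IH False hg by (simp add: word_value_Cons comp_def)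
    qed
  qed simp
  have "satisfies T' e \<longleftrightarrow> satisfies T e" if e_id: "e \<in> identities" for e
  proof -
    obtain u v where e: "e = (u, v)" "u \<noteq> []" "v \<noteq> []"
      using e_id by (auto simp: identities_def)
    show ?thesis
    proof
      assume sat: "satisfies T' e"
      show "satisfies T e"
        unfolding satisfies_def
      proof (intro allI impI)
        fix \<phi> :: "nat \<Rightarrow> 'c" assume \<phi>: "\<forall>x. \<phi> x \<in> carrier T"
        then have g\<phi>: "(g \<circ> \<phi>) x \<in> carrier T'" for x by (simp add: T'_def)
        have "h \<circ> (g \<circ> \<phi>) = \<phi>" using \<phi> hg by auto
        then have "g (word_value T \<phi> u) = g (word_value T \<phi> v)"
          using sat val[of "g \<circ> \<phi>"] g\<phi> e unfolding satisfies_def by (metis fst_conv snd_conv)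
        moreover have "word_value T \<phi> u \<in> carrier T" "word_value T \<phi> v \<in> carrier T"
          using word_value_closed[OF T] \<phi> e by auto
        ultimately show "word_value T \<phi> (fst e) = word_value T \<phi> (snd e)"
          using hg e by (metis fst_conv snd_conv)
      qed
    next
      assume sat: "satisfies T e"
      show "satisfies T' e"
        unfolding satisfies_def
      proof (intro allI impI)
        fix \<phi> :: "nat \<Rightarrow> 'a" assume \<phi>: "\<forall>x. \<phi> x \<in> carrier T'"
        then have "\<forall>x. (h \<circ> \<phi>) x \<in> carrier T"
          using hg by (auto simp: T'_def image_iff) (metis hg)
        then have "word_value T (h \<circ> \<phi>) u = word_value T (h \<circ> \<phi>) v"
          using sat e unfolding satisfies_def by (metis fst_conv snd_conv)
        then show "word_value T' \<phi> (fst e) = word_value T' \<phi> (snd e)"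
          using val \<phi> e by simp
      qed
    qed
  qed
  with sg that show thesis by blast
qed

section \<open>Runs in the \<open>i\<close>-Catalan monoid\<close>

lemma finite_carrier_IC: "finite (carrier (IC m))"
proof -
  have "carrier (IC m) \<subseteq> (\<Union>D\<in>Pow {1..m}. {\<alpha>. dom \<alpha> = D \<and> ran \<alpha> \<subseteq> {1..m}})"
    by (auto simp: IC_def)
  moreover have "finite (\<Union>D\<in>Pow {1..m}. {\<alpha>. dom \<alpha> = D \<and> ran \<alpha> \<subseteq> {1..m}})"
    by (intro finite_UN_I finite_set_of_finite_maps) (auto intro: finite_subset)
  ultimately show ?thesis by (rule finite_subset)
qed

primrec run :: "(nat \<Rightarrow> nat \<rightharpoonup> nat) \<Rightarrow> nat list \<Rightarrow> nat \<rightharpoonup> nat" where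
  "run \<phi> [] i = Some i"
| "run \<phi> (x # w) i = (case \<phi> x i of None \<Rightarrow> None | Some j \<Rightarrow> run \<phi> w j)"

lemma word_value_IC: "w \<noteq> [] \<Longrightarrow> word_value (IC m) \<phi> w = run \<phi> w"
proof (induction w)
  case (Cons x w)
  then show ?case
    by (cases "w = []") (auto simp: word_value_Cons IC_def map_comp_def split: option.splits)
qed simp

text \<open>The letter \<open>y\<close> acts on the path from 1 to \<open>m\<close> whose edge from
  \<open>i\<close> to \<open>Suc i\<close> is labelled \<open>l i\<close> and whose loops at
  \<open>i\<close> are labelled by \<open>P i\<close>. A run from 1 to \<open>m\<close> thus factors
  a word at the letters \<open>l i\<close>, with gaps over the sets \<open>P i\<close>.\<close>

definition path_step :: "nat \<Rightarrow> (nat \<Rightarrow> nat) \<Rightarrow> (nat \<Rightarrow> nat set) \<Rightarrow> nat \<Rightarrow> nat \<rightharpoonup> nat" where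
  "path_step m l P y i =
    (if 1 \<le> i \<and> i < m \<and> y = l i then Some (Suc i)
     else if 1 \<le> i \<and> i \<le> m \<and> y \<in> P i then Some i else None)"

text \<open>Points move by at most one, so a collision needs \<open>i\<close> to move while
  \<open>Suc i\<close> stays. That would put \<open>l i\<close> into
  \<open>P (Suc i)\<close>.\<close>

lemma path_step_in_IC:
  assumes "\<And>i. 1 \<le> i \<Longrightarrow> i < m \<Longrightarrow> l i \<notin> P i \<union> P (Suc i)"
  shows "path_step m l P y \<in> carrier (IC m)"
proof -
  let ?\<alpha> = "path_step m l P y"
  have val: "1 \<le> i \<and> i \<le> m \<and> j \<le> m \<and> (j = i \<or> j = Suc i)" if "?\<alpha> i = Some j" for i j
    using that by (auto simp: path_step_def split: if_splits)
  have no: "?\<alpha> (Suc i) \<noteq> Some (Suc i)" if "?\<alpha> i = Some (Suc i)" for i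
    using that assms[of i] by (auto simp: path_step_def split: if_splits)
  have mono: "j < j'" if "?\<alpha> i = Some j" "?\<alpha> i' = Some j'" "i < i'" for i i' j j'
    using val[OF that(1)] val[OF that(2)] that no[of i] by (cases "i' = Suc i") auto
  have "inj_on ?\<alpha> (dom ?\<alpha>)"
  proof (rule inj_onI)
    fix i i' assume "i \<in> dom ?\<alpha>" "i' \<in> dom ?\<alpha>" "?\<alpha> i = ?\<alpha> i'"
    then show "i = i'" using mono[of i _ i'] mono[of i' _ i]
      by (metis domD less_irrefl linorder_neqE_nat)
  qed
  moreover have "the (?\<alpha> i) \<le> the (?\<alpha> i')" if "i \<in> dom ?\<alpha>" "i' \<in> dom ?\<alpha>" "i \<le> i'" for i i'
    using that mono[of i _ i'] by (cases "i = i'") (auto simp: dom_def less_imp_le)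
  moreover have "dom ?\<alpha> \<subseteq> {1..m}" "ran ?\<alpha> \<subseteq> {1..m}" "\<forall>i\<in>dom ?\<alpha>. i \<le> the (?\<alpha> i)"
    using val by (fastforce simp: dom_def ran_def)+
  ultimately show ?thesis by (simp add: IC_def)
qed

lemma run_path_step_append:
  assumes "1 \<le> i" "i < m" "set p \<subseteq> P i" "l i \<notin> P i"
  shows "run (path_step m l P) (p @ l i # w) i = run (path_step m l P) w (Suc i)"
  using assms by (induction p) (auto simp: path_step_def)

lemma run_path_step_last:
  assumes "1 \<le> m"
  shows "run (path_step m l P) w m = Some m \<longleftrightarrow> set w \<subseteq> P m"
  using assms by (induction w) (auto simp: path_step_def)

lemma run_path_step_split:
  assumes "run (path_step m l P) w i = Some j" "1 \<le> i" "i < m" "i < j"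
  obtains p w' where "w = p @ l i # w'" "set p \<subseteq> P i"
    "run (path_step m l P) w' (Suc i) = Some j"
proof -
  have "\<exists>p w'. w = p @ l i # w' \<and> set p \<subseteq> P i \<and> run (path_step m l P) w' (Suc i) = Some j"
    using assms(1)
  proof (induction w)
    case Nil
    then show ?case using assms(4) by simp
  next
    case (Cons y w)
    show ?case
    proof (cases "y = l i")
      case True
      then have "path_step m l P y i = Some (Suc i)"
        using assms(2,3) by (simp add: path_step_def)
      then have "run (path_step m l P) w (Suc i) = Some j"
        using Cons.prems by simp
      then show ?thesis using True by (intro exI[of _ "[]"] exI[of _ w]) simp
    next
      case False
      then have y: "y \<in> P i"
        using Cons.prems by (auto simp: path_step_def split: if_splits)
      with False have "path_step m l P y i = Some i"
        using assms(2,3) by (simp add: path_step_def)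
      then have "run (path_step m l P) w i = Some j"
        using Cons.prems by simp
      with Cons.IH obtain p w' where
        "w = p @ l i # w'" "set p \<subseteq> P i" "run (path_step m l P) w' (Suc i) = Some j" by blast
      with y show ?thesis by (intro exI[of _ "y # p"] exI[of _ w']) simp
    qed
  qed
  with that show thesis by blast
qed

text \<open>Four points allow three moves. The word \<open>u\<close> labels a run from 1 to 4 that
  moves at \<open>s\<close>, \<open>x\<close> and \<open>t\<close> and loops on the letters in
  between; \<open>v\<close> then labels such a run too, and its factors are read off.\<close>

lemma IC4_path:
  assumes sat: "satisfies (IC 4) (u, v)"
    and u: "u = p0 @ s # p1 @ x # p2 @ t # p3" and v: "v \<noteq> []"
    and s: "s \<notin> set p0 \<union> set p1" and x: "x \<notin> set p1 \<union> set p2" and t: "t \<notin> set p2 \<union> set p3"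
  obtains q0 q1 q2 q3 where "v = q0 @ s # q1 @ x # q2 @ t # q3"
    "set q0 \<subseteq> set p0" "set q1 \<subseteq> set p1" "set q2 \<subseteq> set p2" "set q3 \<subseteq> set p3"
proof -
  define l where "l i = (if i = 1 then s else if i = 2 then x else t)" for i :: nat
  define P where "P i = (if i = 1 then set p0 else if i = 2 then set p1
    else if i = 3 then set p2 else set p3)" for i :: nat
  have l: "l 1 = s" "l 2 = x" "l 3 = t" by (auto simp: l_def)
  have P: "P 1 = set p0" "P 2 = set p1" "P 3 = set p2" "P 4 = set p3" by (auto simp: P_def)
  let ?r = "run (path_step 4 l P)"
  have "l i \<notin> P i \<union> P (Suc i)" if "1 \<le> i" "i < 4" for i
  proof -
    have "i = 1 \<or> i = 2 \<or> i = 3" using that by auto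
    then show ?thesis using s x t by (auto simp: l_def P_def)
  qed
  then have "path_step 4 l P y \<in> carrier (IC 4)" for y by (rule path_step_in_IC)
  then have "?r u = ?r v"
    using sat word_value_IC[of u 4] word_value_IC[OF v, of 4] u by (simp add: satisfies_def)
  moreover have "?r u 1 = Some 4"
    using run_path_step_append[of 1 4 p0 P l "p1 @ x # p2 @ t # p3"]
      run_path_step_append[of 2 4 p1 P l "p2 @ t # p3"]
      run_path_step_append[of 3 4 p2 P l "p3"] run_path_step_last[of 4 l P p3] s x t u l P
    by (simp flip: numeral_2_eq_2)
  ultimately have "?r v 1 = Some 4" by simp
  then obtain q0 v1 where 1: "v = q0 @ s # v1" "set q0 \<subseteq> set p0" "?r v1 2 = Some 4"
    using run_path_step_split[of 4 l P v 1 4] l P by (metis Suc_1 le_refl one_less_numeral_iff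
        semiring_norm(76))
  obtain q1 v2 where 2: "v1 = q1 @ x # v2" "set q1 \<subseteq> set p1" "?r v2 3 = Some 4"
    using run_path_step_split[OF 1(3)] l P by auto
  obtain q2 q3 where 3: "v2 = q2 @ t # q3" "set q2 \<subseteq> set p2" "?r q3 4 = Some 4"
    using run_path_step_split[OF 2(3)] l P by auto
  have "set q3 \<subseteq> set p3" using 3(3) run_path_step_last[of 4] P by auto
  with 1 2 3 that show thesis by simp
qed

section \<open>Rigid words\<close>

lemma append_Cons_unique:
  "x \<notin> set a \<Longrightarrow> x \<notin> set a' \<Longrightarrow> a @ x # b = a' @ x # b' \<Longrightarrow> a = a' \<and> b = b'"
proof (induction a arbitrary: a')
  case Nil
  then show ?case by (cases a') auto
next
  case (Cons y a)
  then show ?case by (cases a') auto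
qed

text \<open>The split at the first letter of \<open>r\<close> puts it first in \<open>r'\<close>,
  and distinctness keeps it out of the rest. Cancelling it leaves the same hypotheses for the
  tails.\<close>

lemma eq_by_splits:
  assumes "distinct r" "set r' \<subseteq> set r"
    and "\<And>r1 x r2. r = r1 @ x # r2 \<Longrightarrow>
      \<exists>p1 p2. r' = p1 @ x # p2 \<and> set p1 \<subseteq> set r1 \<and> set p2 \<subseteq> set r2"
  shows "r' = r"
  using assms
proof (induction r arbitrary: r')
  case (Cons x r)
  obtain p2 where r': "r' = x # p2" "set p2 \<subseteq> set r"
    using Cons.prems(3)[of "[]" x r] by auto
  have "p2 = r"
  proof (rule Cons.IH)
    fix r1 y r2 assume r: "r = r1 @ y # r2"
    obtain p1 q2 where p: "r' = p1 @ y # q2" "set p1 \<subseteq> insert x (set r1)" "set q2 \<subseteq> set r2"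
      using Cons.prems(3)[of "x # r1" y r2] r by auto
    have "y \<noteq> x" using Cons.prems(1) r by auto
    then obtain p1' where p1': "p1 = x # p1'" "p2 = p1' @ y # q2"
      using p(1) r'(1) by (cases p1) auto
    have "x \<notin> set p1'" using p1' r'(2) Cons.prems(1) by auto
    then have "set p1' \<subseteq> set r1" using p(2) p1' by auto
    then show "\<exists>p1 p2'. p2 = p1 @ y # p2' \<and> set p1 \<subseteq> set r1 \<and> set p2' \<subseteq> set r2"
      using p1' p(3) by blast
  qed (use Cons.prems(1) r' in auto)
  then show ?case using r' by simp
qed simp

section \<open>Reconstruction of a word from its linear letters\<close>

definition linear_in :: "nat \<Rightarrow> nat list \<Rightarrow> bool" where
  "linear_in x u \<longleftrightarrow> count_list u x = 1"

definition separated :: "nat list \<Rightarrow> bool" where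
  "separated u \<longleftrightarrow> (\<forall>p x q r. u = p @ x # q @ x # r \<longrightarrow> (\<exists>y\<in>set q. linear_in y u))"

lemma linear_in_split: "linear_in x (p @ x # q) \<longleftrightarrow> x \<notin> set p \<union> set q"
  by (auto simp: linear_in_def count_list_0_iff)

lemma separated_distinct:
  assumes "separated (a @ r @ b)" "\<And>y. y \<in> set r \<Longrightarrow> \<not> linear_in y (a @ r @ b)"
  shows "distinct r"
proof (rule ccontr)
  assume "\<not> distinct r"
  then obtain p x q s where r: "r = p @ [x] @ q @ [x] @ s"
    using not_distinct_decomp by blast
  then have "a @ r @ b = (a @ p) @ x # q @ x # (s @ b)" by simp
  then obtain y where "y \<in> set q" "linear_in y (a @ r @ b)"
    using assms(1) unfolding separated_def by blast
  then show False using assms(2) r by auto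
qed

text \<open>Paths that move at \<open>s\<close>, at a letter of \<open>r\<close> and at
  \<open>t\<close> supply the splits for \<open>eq_by_splits\<close>. This carries agreement of the
  two words from one linear letter to the next.\<close>

lemma IC4_block:
  assumes sat: "satisfies (IC 4) (u, v)" and v: "v = a @ s # c"
    and u: "u = a @ s # r @ t # b @ [z]"
    and s: "linear_in s u" and t: "linear_in t u" and z: "linear_in z u" and r: "distinct r"
  obtains d where "v = a @ s # r @ t # d"
proof -
  have s': "s \<notin> set a" "s \<notin> set r" "s \<noteq> t" "s \<notin> set b"
    using s linear_in_split[of s a "r @ t # b @ [z]"] u by auto
  have t': "t \<notin> set a" "t \<notin> set r" "t \<notin> set b" "t \<noteq> z"
    using t linear_in_split[of t "a @ s # r" "b @ [z]"] u by auto
  have z': "z \<notin> set b"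
    using z linear_in_split[of z "a @ s # r @ t # b" "[]"] u by auto
  define r' where "r' = takeWhile (\<lambda>y. y \<noteq> t) c"
  \<comment> \<open>As \<open>s\<close> is not in \<open>a\<close>, the first \<open>s\<close> in
    \<open>v\<close> is the one after \<open>a\<close>. All factorizations obtained from paths
    therefore share the segment \<open>r'\<close> between \<open>s\<close> and the next
    \<open>t\<close>.\<close>
  have r'I: "q = r'" if "v = q0 @ s # q @ t # d" "s \<notin> set q0" "t \<notin> set q" for q0 q d
  proof -
    have "c = q @ t # d" using append_Cons_unique[of s a q0 c "q @ t # d"] that v s' by simp
    moreover have "\<forall>y\<in>set q. y \<noteq> t" using that(3) by auto
    ultimately show ?thesis by (simp add: r'_def takeWhile_append2)
  qed
  have splits: "\<exists>p1 p2. r' = p1 @ x # p2 \<and> set p1 \<subseteq> set r1 \<and> set p2 \<subseteq> set r2"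
    if r12: "r = r1 @ x # r2" for r1 x r2
  proof -
    have "u = a @ s # r1 @ x # r2 @ t # (b @ [z])" using u r12 by simp
    then obtain q0 q1 q2 q3 where q: "v = q0 @ s # q1 @ x # q2 @ t # q3"
      "set q0 \<subseteq> set a" "set q1 \<subseteq> set r1" "set q2 \<subseteq> set r2"
      by (rule IC4_path[OF sat]) (use v s' t' r r12 in auto)
    have "q1 @ x # q2 = r'"
      by (rule r'I[of q0 _ q3]) (use q s' t' r12 in auto)
    with q show ?thesis by blast
  qed
  \<comment> \<open>With no letter of \<open>r\<close> for the middle move, the path moves at
    \<open>s\<close>, \<open>t\<close> and \<open>z\<close>, and the loop set between
    \<open>s\<close> and \<open>t\<close> is empty.\<close>
  have empty: "r' = []" "t \<in> set c" if "r = []"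
  proof -
    have "u = a @ s # [] @ t # b @ z # []" using u that by simp
    then obtain q0 q1 q2 q3 where q: "v = q0 @ s # q1 @ t # q2 @ z # q3"
      "set q0 \<subseteq> set a" "set q1 \<subseteq> set []"
      by (rule IC4_path[OF sat]) (use v s' t' z' in auto)
    then show "r' = []" using r'I[of q0 "[]" "q2 @ z # q3"] s' subsetD[OF q(2), of s] by auto
    have sq: "s \<notin> set q0" using q(2) s'(1) by blast
    have "c = q1 @ t # q2 @ z # q3"
      using append_Cons_unique[OF s'(1) sq] v q(1) by blast
    then show "t \<in> set c" by simp
  qed
  have "r' = r \<and> t \<in> set c"
  proof (cases r)
    case Nil
    then show ?thesis using empty by simp
  next
    case (Cons y r2)
    have "u = a @ s # [] @ y # r2 @ t # (b @ [z])" using u Cons by simp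
    then obtain q0 q1 q2 q3 where q: "v = q0 @ s # q1 @ y # q2 @ t # q3"
      "set q0 \<subseteq> set a" "set q1 \<subseteq> set []" "set q2 \<subseteq> set r2"
      by (rule IC4_path[OF sat]) (use v s' t' r Cons in auto)
    have sq: "s \<notin> set q0" using q(2) s'(1) by blast
    have "c = q1 @ y # q2 @ t # q3"
      using append_Cons_unique[OF s'(1) sq] v q(1) by blast
    then have "t \<in> set c" by simp
    moreover have "set r' \<subseteq> set r"
      using splits[of "[]" y r2] Cons by auto
    ultimately show ?thesis using eq_by_splits[OF r _ splits] by blast
  qed
  then have "c = r @ t # tl (dropWhile (\<lambda>y. y \<noteq> t) c)"
    by (metis (mono_tags, lifting) r'_def dropWhile_eq_Nil_conv hd_dropWhile list.collapse
        takeWhile_dropWhile_id)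
  with v that show thesis by simp
qed

text \<open>The three letters added around \<open>u\<close> and \<open>v\<close> make the first and the last block of the padded
  words bounded by linear letters, as all inner blocks are.\<close>

lemma separated_isoterm:
  assumes sg: "is_semigroup (IC 4)" and sat: "satisfies (IC 4) (u, v)"
    and ne: "u \<noteq> []" "v \<noteq> []" and sep: "separated u"
  shows "u = v"
proof -
  define k where "k = Suc (Max (set u \<union> set v))"
  have fresh: "y < k" if "y \<in> set u \<union> set v" for y
    using that by (simp add: k_def less_Suc_eq_le)
  \<comment> \<open>\<open>k\<close> opens the first block, \<open>Suc k\<close> closes the last
    one, and \<open>Suc (Suc k)\<close> is the linear letter \<open>z\<close> of
    \<open>IC4_block\<close>.\<close>
  define U where "U = k # u @ [Suc k, Suc (Suc k)]"
  define V where "V = k # v @ [Suc k, Suc (Suc k)]"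
  have satU: "satisfies (IC 4) (U, V)"
    using satisfies_context[OF sg sat ne, of "[k]" "[Suc k, Suc (Suc k)]"]
    by (simp add: U_def V_def)
  have lin: "linear_in y U \<longleftrightarrow> y \<in> {k, Suc k, Suc (Suc k)} \<or> linear_in y u" for y
    using fresh[of k] fresh[of "Suc k"] fresh[of "Suc (Suc k)"]
    by (auto simp: linear_in_def U_def count_list_0_iff)
  have sepU: "separated U"
    unfolding separated_def
  proof (intro allI impI)
    fix p x q r assume split: "U = p @ x # q @ x # r"
    have "count_list U x \<ge> 2" using split by simp
    then have nl: "\<not> linear_in x U" by (simp add: linear_in_def)
    then have x: "x \<notin> {k, Suc k, Suc (Suc k)}" using lin by blast
    \<comment> \<open>Both occurrences of \<open>x\<close> lie in \<open>u\<close>, so the padding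
      is peeled off to split \<open>u\<close> in the same way.\<close>
    obtain p' where p: "p = k # p'" using split x by (cases p) (auto simp: U_def)
    have eq: "u @ [Suc k, Suc (Suc k)] = (p' @ x # q @ [x]) @ r"
      using split p by (simp add: U_def)
    have "r \<noteq> []"
      using arg_cong[OF eq, of last] x by auto
    then obtain r1 z' where r1: "r = r1 @ [z']" by (cases r rule: rev_cases) auto
    have eq1: "u @ [Suc k] = (p' @ x # q @ [x]) @ r1"
      using arg_cong[OF eq, of butlast] r1 by (simp add: butlast_append)
    have "r1 \<noteq> []"
      using arg_cong[OF eq1, of last] x by auto
    then obtain r' z where "r1 = r' @ [z]" by (cases r1 rule: rev_cases) auto
    with eq1 have "u = p' @ x # q @ x # r'"
      using arg_cong[OF eq1, of butlast] by (simp add: butlast_append)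
    then show "\<exists>y\<in>set q. linear_in y U" using sep lin unfolding separated_def by blast
  qed
  have z: "linear_in (Suc (Suc k)) U" using lin by simp
  \<comment> \<open>Linear letters are treated from left to right, starting at \<open>k\<close>:
    agreement up to the last linear letter \<open>s'\<close> before \<open>s\<close> extends to
    \<open>s\<close>.\<close>
  have prefix: "\<exists>c. V = a @ s # c"
    if "U = a @ s # b @ [Suc (Suc k)]" "linear_in s U" for a s b
    using that
  proof (induction a arbitrary: s b rule: length_induct)
    case (1 a)
    show ?case
    proof (cases "a = []")
      case True
      then show ?thesis using 1(2) by (simp add: U_def V_def)
    next
      case False
      then have "\<exists>y\<in>set a. linear_in y U" using 1(2) lin by (cases a) (auto simp: U_def)
      then obtain a0 s' r where a: "a = a0 @ s' # r" "linear_in s' U"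
        "\<forall>y\<in>set r. \<not> linear_in y U"
        by (rule split_list_last_propE)
      have U: "U = a0 @ s' # r @ s # b @ [Suc (Suc k)]" using a 1(2) by simp
      have "\<exists>c. V = a0 @ s' # c"
        using 1(1)[rule_format, of a0 s' "r @ s # b"] a U by simp
      then obtain c where "V = a0 @ s' # c" ..
      moreover have "distinct r"
        by (rule separated_distinct[of "a0 @ [s']" _ "s # b @ [Suc (Suc k)]"])
          (use sepU a U in auto)
      ultimately obtain d where "V = a0 @ s' # r @ s # d"
        using IC4_block[OF satU _ U a(2) 1(3) z] by blast
      with a show ?thesis by simp
    qed
  qed
  \<comment> \<open>At \<open>Suc k\<close> the common prefix contains all of \<open>u\<close>; as
    \<open>Suc k\<close> is a new letter, \<open>v\<close> ends there as well.\<close>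
  have "U = (k # u) @ Suc k # [] @ [Suc (Suc k)]" by (simp add: U_def)
  then obtain c where "V = (k # u) @ Suc k # c" using prefix lin by blast
  then have "(k # v) @ Suc k # [Suc (Suc k)] = (k # u) @ Suc k # c" by (simp add: V_def)
  then show ?thesis
    using append_Cons_unique[of "Suc k" "k # v" "k # u"] fresh[of "Suc k"] by auto
qed

lemma not_linear_split:
  assumes "y \<in> set u" "\<not> linear_in y u"
  obtains a b c where "u = a @ y # b @ y # c"
proof -
  obtain a d where a: "u = a @ y # d" "y \<notin> set a"
    using split_list_first[OF assms(1)] by blast
  then have "y \<in> set d" using assms(2) linear_in_split by blast
  then show thesis using a that by (metis split_list)
qed

text \<open>A letter occurring twice in \<open>u\<close> has a one-letter image, so a long stretch of
  such letters would be a window of \<open>U\<close> with more distinct letters than \<open>u\<close> has variables.\<close>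

lemma separated_preimage:
  assumes pairs: "\<And>i j. Suc i < length U \<Longrightarrow> Suc j < length U \<Longrightarrow> U ! i = U ! j \<Longrightarrow>
      U ! Suc i = U ! Suc j \<Longrightarrow> i = j"
    and window: "\<And>i j. i < j \<Longrightarrow> j < length U \<Longrightarrow> j - i < n \<Longrightarrow> U ! i \<noteq> U ! j"
    and sub: "sublist (concat (map \<theta> u)) U" and ne: "\<And>x. x \<in> set u \<Longrightarrow> \<theta> x \<noteq> []"
    and few: "card (set u) < n"
  shows "separated u"
  unfolding separated_def
proof (intro allI impI, rule ccontr)
  fix p x q r assume u: "u = p @ x # q @ x # r" and nl: "\<not> (\<exists>y\<in>set q. linear_in y u)"
  obtain A B where U: "U = A @ concat (map \<theta> u) @ B" using sub by (auto simp: sublist_def)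
  have "\<not> linear_in x u" using u by (simp add: linear_in_def)
  with nl have nl': "\<not> linear_in y u" if "y \<in> set (x # q)" for y using that by auto
  \<comment> \<open>Otherwise two occurrences of \<open>y\<close> place the first two letters of
    \<open>\<theta> y\<close> at two positions of \<open>U\<close>.\<close>
  have single: "\<theta> y = [hd (\<theta> y)]" if y: "y \<in> set (x # q)" for y
  proof (rule ccontr)
    assume "\<theta> y \<noteq> [hd (\<theta> y)]"
    moreover have "y \<in> set u" using y u by auto
    ultimately obtain l1 l2 L where \<theta>: "\<theta> y = l1 # l2 # L"
      using ne by (metis list.sel(1) neq_Nil_conv)
    obtain a b c where abc: "u = a @ y # b @ y # c"
      using not_linear_split \<open>y \<in> set u\<close> nl'[OF y] by blast
    define X where "X = A @ concat (map \<theta> a)"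
    define X' where "X' = X @ \<theta> y @ concat (map \<theta> b)"
    have at: "U ! length Z = l1" "U ! Suc (length Z) = l2" "Suc (length Z) < length U"
      if "U = Z @ l1 # l2 # Y" for Z Y
      using that by (simp_all add: nth_append)
    have "U = X @ l1 # l2 # (L @ concat (map \<theta> b) @ \<theta> y @ concat (map \<theta> c) @ B)"
      by (simp add: U abc X_def \<theta>)
    moreover have "U = X' @ l1 # l2 # (L @ concat (map \<theta> c) @ B)"
      by (simp add: U abc X_def X'_def \<theta>)
    ultimately have "length X = length X'" using at pairs by metis
    then show False by (simp add: X'_def \<theta>)
  qed
  define g where "g y = hd (\<theta> y)" for y
  define ys where "ys = x # q"
  define A' where "A' = A @ concat (map \<theta> p)"
  have "map \<theta> ys = map (\<lambda>y. [g y]) ys"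
    using single by (simp add: ys_def g_def)
  then have "concat (map \<theta> ys) = map g ys"
    by (simp only: concat_map_singleton)
  moreover have "\<theta> x = [g x]" using single by (simp add: g_def)
  ultimately have U': "U = A' @ map g ys @ g x # (concat (map \<theta> r) @ B)"
    by (simp add: U u A'_def ys_def)
  have len: "length A' + length ys < length U" using U' by simp
  have nth: "U ! (length A' + i) = g (ys ! i)" if "i < length ys" for i
    using that by (simp add: U' nth_append)
  \<comment> \<open>A short \<open>ys\<close> brings the letter \<open>g x\<close> back within a
    window. A long one has \<open>n\<close> letters with distinct images, more than \<open>u\<close>
    has variables.\<close>
  show False
  proof (cases "length ys < n")
    case True
    have "U ! (length A' + length ys) = g x" by (simp add: U' nth_append)
    moreover have "U ! (length A' + 0) = g x"
      using nth[of 0] by (simp add: ys_def)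
    ultimately show False
      using window[of "length A'" "length A' + length ys"] True len by (simp add: ys_def)
  next
    case False
    have "map g (take n ys) ! i \<noteq> map g (take n ys) ! j" if "i < j" "j < n" for i j
      using window[of "length A' + i" "length A' + j"] nth[of i] nth[of j] that False len by simp
    then have "distinct (map g (take n ys))"
      using False by (auto simp: distinct_conv_nth) (metis linorder_neqE_nat)
    then have "card (set (take n ys)) = n"
      using False by (simp add: distinct_map distinct_card)
    moreover have "set (take n ys) \<subseteq> set u"
      using set_take_subset[of n ys] u by (auto simp: ys_def)
    ultimately show False using few card_mono[of "set u" "set (take n ys)"] by simp
  qed
qed

section \<open>Rees quotients by the non-factors of a word\<close>

text \<open>\<open>None\<close> is the zero to which the words that are not factors of
  \<open>U\<close> collapse.\<close>

definition factor_semigroup :: "nat list \<Rightarrow> nat list option magma" where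
  "factor_semigroup U =
    \<lparr>carrier = insert None (Some ` {w. w \<noteq> [] \<and> sublist w U}),
     mul = (\<lambda>a b. case a of None \<Rightarrow> None | Some x \<Rightarrow>
       (case b of None \<Rightarrow> None | Some y \<Rightarrow> if sublist (x @ y) U then Some (x @ y) else None))\<rparr>"

lemma factor_semigroup_mul:
  "a \<cdot>\<^bsub>factor_semigroup U\<^esub> b = Some z \<longleftrightarrow>
    (\<exists>x y. a = Some x \<and> b = Some y \<and> z = x @ y \<and> sublist z U)"
  by (auto simp: factor_semigroup_def split: option.splits)

lemma is_semigroup_factor_semigroup: "is_semigroup (factor_semigroup U)"
proof -
  let ?M = "factor_semigroup U"
  have "a \<cdot>\<^bsub>?M\<^esub> b \<in> carrier ?M" if "a \<in> carrier ?M" "b \<in> carrier ?M" for a b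
    using that by (auto simp: factor_semigroup_def split: option.splits)
  moreover have "(a \<cdot>\<^bsub>?M\<^esub> b) \<cdot>\<^bsub>?M\<^esub> c = a \<cdot>\<^bsub>?M\<^esub> (b \<cdot>\<^bsub>?M\<^esub> c)" for a b c
  proof -
    have sub: "sublist (x @ y) U" "sublist (y @ z) U" if xyz: "sublist (x @ y @ z) U" for x y z
    proof -
      obtain A B where "U = A @ (x @ y @ z) @ B" using xyz unfolding sublist_def by blast
      then have "U = A @ (x @ y) @ (z @ B)" "U = (A @ x) @ (y @ z) @ B" by simp_all
      then show "sublist (x @ y) U" "sublist (y @ z) U" unfolding sublist_def by blast+
    qed
    \<comment> \<open>Either bracketing is nonzero exactly when the whole concatenation is a factor
      of \<open>U\<close>, since its parts are then factors too.\<close>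
    have "(a \<cdot>\<^bsub>?M\<^esub> b) \<cdot>\<^bsub>?M\<^esub> c = Some z \<longleftrightarrow> a \<cdot>\<^bsub>?M\<^esub> (b \<cdot>\<^bsub>?M\<^esub> c) = Some z" for z
      by (auto simp: factor_semigroup_mul intro: sub)
    then show ?thesis by (metis not_None_eq)
  qed
  ultimately show ?thesis
    unfolding is_semigroup_def by (simp add: factor_semigroup_def)
qed

lemma finite_factor_semigroup: "finite (carrier (factor_semigroup U))"
proof -
  have "{w. w \<noteq> [] \<and> sublist w U} \<subseteq> {w. set w \<subseteq> set U \<and> length w \<le> length U}"
    by (auto simp: sublist_length_le dest: set_mono_sublist)
  then have "finite {w. w \<noteq> [] \<and> sublist w U}"
    by (rule finite_subset) (rule finite_lists_length_le[OF finite_set])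
  then show ?thesis by (simp add: factor_semigroup_def)
qed

lemma word_value_factor_semigroup:
  assumes "word_value (factor_semigroup U) \<phi> w = Some z" "w \<noteq> []"
  shows "z = concat (map (the \<circ> \<phi>) w) \<and> (\<forall>x\<in>set w. \<phi> x \<noteq> None)"
  using assms
proof (induction w arbitrary: z)
  case (Cons x w)
  then show ?case
    by (cases "w = []") (auto simp: word_value_Cons factor_semigroup_mul)
qed simp

lemma word_value_factor_semigroup_letters:
  assumes "sublist w U" "w \<noteq> []" "\<And>x. x \<in> set w \<Longrightarrow> \<phi> x = Some [x]"
  shows "word_value (factor_semigroup U) \<phi> w = Some w"
  using assms
proof (induction w)
  case (Cons x w)
  obtain A B where "U = A @ (x # w) @ B" using Cons.prems(1) unfolding sublist_def by blast
  then have "U = (A @ [x]) @ w @ B" by simp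
  then have "sublist w U" unfolding sublist_def by blast
  with Cons show ?case
    by (cases "w = []") (auto simp: word_value_Cons factor_semigroup_mul)
qed simp

text \<open>A side with nonzero value is mapped onto a factor of \<open>U\<close>, hence is
  separated, and then both sides are the same word. Otherwise both values are zero.\<close>

lemma factor_semigroup_satisfies:
  assumes pairs: "\<And>i j. Suc i < length U \<Longrightarrow> Suc j < length U \<Longrightarrow> U ! i = U ! j \<Longrightarrow>
      U ! Suc i = U ! Suc j \<Longrightarrow> i = j"
    and window: "\<And>i j. i < j \<Longrightarrow> j < length U \<Longrightarrow> j - i < n \<Longrightarrow> U ! i \<noteq> U ! j"
    and sg: "is_semigroup (IC 4)" and sat: "satisfies (IC 4) (u, v)" and ne: "u \<noteq> []" "v \<noteq> []"
    and few: "card (set u) < n" "card (set v) < n"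
  shows "satisfies (factor_semigroup U) (u, v)"
  unfolding satisfies_def
proof (intro allI impI)
  let ?M = "factor_semigroup U"
  fix \<phi> :: "nat \<Rightarrow> nat list option" assume \<phi>: "\<forall>x. \<phi> x \<in> carrier ?M"
  have sep: "separated w"
    if w: "word_value ?M \<phi> w = Some z" "w \<noteq> []" "card (set w) < n" for w z
  proof -
    note z = word_value_factor_semigroup[OF w(1,2)]
    have "word_value ?M \<phi> w \<in> carrier ?M"
      using word_value_closed[OF is_semigroup_factor_semigroup] \<phi> w(2) by blast
    then have "sublist (concat (map (the \<circ> \<phi>) w)) U"
      using w(1) z by (auto simp: factor_semigroup_def)
    moreover have "(the \<circ> \<phi>) x \<noteq> []" if "x \<in> set w" for x
    proof -
      have "\<phi> x \<noteq> None" using z that by blast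
      then show ?thesis using \<phi>[rule_format, of x] by (auto simp: factor_semigroup_def)
    qed
    ultimately show ?thesis using separated_preimage[OF pairs window] w(3) by blast
  qed
  have sat': "satisfies (IC 4) (v, u)" using sat by (simp add: satisfies_def)
  have "word_value ?M \<phi> u = word_value ?M \<phi> v"
  proof (cases "word_value ?M \<phi> u")
    case None
    then show ?thesis
      using sep[of v] separated_isoterm[OF sg sat' ne(2,1)] ne few
      by (cases "word_value ?M \<phi> v") auto
  next
    case (Some z)
    then show ?thesis
      using sep[of u] separated_isoterm[OF sg sat ne] ne few by auto
  qed
  then show "word_value ?M \<phi> (fst (u, v)) = word_value ?M \<phi> (snd (u, v))" by simp
qed

section \<open>A word in which short patterns are rigid\<close>

text \<open>The sequence consists of blocks of length \<open>p\<close>. The \<open>k\<close>-th block runs through the residues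
  modulo \<open>p\<close> in steps of \<open>k + 1\<close>, so that a pair of adjacent letters determines its block.\<close>

definition step_sum :: "nat \<Rightarrow> nat \<Rightarrow> nat" where
  "step_sum p i = (\<Sum>l<i. l div p + 1)"

definition letter :: "nat \<Rightarrow> nat \<Rightarrow> nat" where
  "letter p i = step_sum p i mod p"

lemma step_sum_split: "i \<le> j \<Longrightarrow> step_sum p j = step_sum p i + (\<Sum>l=i..<j. l div p + 1)"
  unfolding step_sum_def lessThan_atLeast0
  by (simp add: sum.atLeastLessThan_concat)

text \<open>Moving \<open>d\<close> positions inside block \<open>k\<close> adds
  \<open>d * (k + 1)\<close>, where \<open>d < p\<close> and \<open>p\<close> does not divide
  \<open>k + 1\<close>.\<close>

lemma letter_inj_on_block:
  assumes "prime p" "k + 1 < p"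
  shows "inj_on (letter p) {i. i div p = k}"
proof -
  have "i = j" if "i \<le> j" "i div p = k" "j div p = k" "letter p i = letter p j" for i j
  proof -
    have "l div p = k" if "l \<in> {i..<j}" for l
      using div_le_mono[of i l p] div_le_mono[of l j p] that \<open>i div p = k\<close> \<open>j div p = k\<close> by simp
    then have "step_sum p j = step_sum p i + (j - i) * (k + 1)"
      using step_sum_split[OF that(1), of p] by simp
    then have "p dvd (j - i) * (k + 1)"
      using that(4) mod_eq_dvd_iff_nat[of "step_sum p i" "step_sum p j" p]
      by (simp add: letter_def)
    then have "p dvd j - i"
      using assms prime_dvd_mult_nat[of p "j - i" "k + 1"] by (auto dest: dvd_imp_le)
    moreover have "j - i < p"
    proof -
      have "j mod p < p" using assms(2) by simp
      moreover have "i = k * p + i mod p" "j = k * p + j mod p"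
        using that div_mult_mod_eq[of i p] div_mult_mod_eq[of j p] by auto
      ultimately show ?thesis by linarith
    qed
    ultimately show "i = j" using that(1) by (auto dest: dvd_imp_le)
  qed
  then show ?thesis by (intro inj_onI) (metis mem_Collect_eq nat_le_linear)
qed

text \<open>Distinct letters at \<open>p\<close> positions exhaust the \<open>p\<close> residues.
  All blocks thus have the same content.\<close>

lemma letter_surj_on_block:
  assumes "prime p" "k + 1 < p" "c < p"
  shows "\<exists>i. k * p \<le> i \<and> i < Suc k * p \<and> letter p i = c"
proof -
  let ?B = "{k * p..<Suc k * p}"
  have "i div p = k" if "i \<in> ?B" for i
    using that by (auto intro!: div_nat_eqI simp: algebra_simps)
  then have "inj_on (letter p) ?B"
    using letter_inj_on_block[OF assms(1,2)] by (auto intro: inj_on_subset)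
  then have "card (letter p ` ?B) = p" by (simp add: card_image)
  moreover have "letter p ` ?B \<subseteq> {..<p}" using assms(2) by (auto simp: letter_def)
  ultimately have "letter p ` ?B = {..<p}" by (simp add: card_subset_eq)
  then obtain i where "i \<in> ?B" "letter p i = c" using assms(3) by (metis imageE lessThan_iff)
  then show ?thesis by auto
qed

text \<open>The letters differ by a sum of fewer than \<open>n\<close> increments, each from 1 to
  \<open>N\<close>, which lies strictly between 0 and \<open>p\<close>. The position
  \<open>N * p\<close> is included, as only increments before \<open>j\<close> enter.\<close>

lemma letter_window:
  assumes "i < j" "j - i < n" "j \<le> N * p" "N * n < p"
  shows "letter p i \<noteq> letter p j"
proof
  assume "letter p i = letter p j"
  let ?D = "\<Sum>l=i..<j. l div p + 1"
  have sum: "step_sum p j = step_sum p i + ?D" using step_sum_split assms(1) by simp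
  then have "p dvd ?D"
    using \<open>letter p i = letter p j\<close> mod_eq_dvd_iff_nat[of "step_sum p i" "step_sum p j" p]
    by (simp add: letter_def)
  moreover have "?D \<ge> (\<Sum>l=i..<j. 1)" by (intro sum_mono) simp
  then have "?D > 0" using assms(1) by simp
  ultimately have "p \<le> ?D" by (rule dvd_imp_le)
  also have "l div p + 1 \<le> N" if "l \<in> {i..<j}" for l
    using less_mult_imp_div_less[of l N p] that assms(3) by simp
  then have "?D \<le> (\<Sum>l=i..<j. N)" by (rule sum_mono)
  also have "\<dots> = (j - i) * N" by simp
  also have "\<dots> \<le> N * n" using assms(2) by (simp add: mult.commute)
  finally show False using assms(4) by simp
qed

text \<open>The difference of the two letters is the increment modulo \<open>p\<close>, and
  increments lie between 1 and \<open>p - 1\<close>. It determines the block, and the first letter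
  determines the position in it.\<close>

lemma letter_pair:
  assumes "prime p" "N < p" "i < N * p" "j < N * p"
    and "letter p i = letter p j" "letter p (Suc i) = letter p (Suc j)"
  shows "i = j"
proof -
  define x y r where "x = i div p + 1" and "y = j div p + 1" and "r = letter p i"
  have xy: "0 < x" "x < p" "0 < y" "y < p"
    using less_mult_imp_div_less[of i N p] less_mult_imp_div_less[of j N p] assms
    by (auto simp: x_def y_def)
  have "letter p (Suc l) = (letter p l + (l div p + 1)) mod p" for l
    by (simp only: letter_def step_sum_def sum.lessThan_Suc mod_add_left_eq)
  then have "(r + x) mod p = (r + y) mod p"
    using assms(5,6) by (metis r_def x_def y_def)
  moreover have "r < p" using xy by (simp add: r_def letter_def)
  ultimately have "x = y" using xy by (auto simp: mod_if split: if_splits)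
  then have "i div p = j div p" by (simp add: x_def y_def)
  moreover have "i div p + 1 < p" using xy by (simp add: x_def)
  ultimately show ?thesis
    using letter_inj_on_block[OF assms(1), of "i div p"] assms(5) by (auto dest: inj_onD)
qed

section \<open>Finite \<open>\<R>\<close>-trivial semigroups\<close>

text \<open>Each of \<open>a\<close> and its product with \<open>x\<close> is a right multiple of
  the other, so both generate the same right ideal.\<close>

lemma R_trivial_absorb:
  assumes "is_semigroup S" "R_trivial S" "a \<in> carrier S" "x \<in> carrier S" "y \<in> carrier S"
    and "(a \<cdot>\<^bsub>S\<^esub> x) \<cdot>\<^bsub>S\<^esub> y = a"
  shows "a \<cdot>\<^bsub>S\<^esub> x = a"
proof -
  note [simp] = semigroup_closed[OF assms(1)] semigroup_assoc[OF assms(1)]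
  let ?b = "a \<cdot>\<^bsub>S\<^esub> x"
  have sub: "(\<lambda>s. (c \<cdot>\<^bsub>S\<^esub> z) \<cdot>\<^bsub>S\<^esub> s) ` carrier S \<union> {c \<cdot>\<^bsub>S\<^esub> z} \<subseteq> (\<lambda>s. c \<cdot>\<^bsub>S\<^esub> s) ` carrier S \<union> {c}"
    if "c \<in> carrier S" "z \<in> carrier S" for c z
    using that by auto
  have "(\<lambda>s. ?b \<cdot>\<^bsub>S\<^esub> s) ` carrier S \<union> {?b} = (\<lambda>s. a \<cdot>\<^bsub>S\<^esub> s) ` carrier S \<union> {a}"
  proof (rule antisym)
    show "(\<lambda>s. a \<cdot>\<^bsub>S\<^esub> s) ` carrier S \<union> {a} \<subseteq> (\<lambda>s. ?b \<cdot>\<^bsub>S\<^esub> s) ` carrier S \<union> {?b}"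
      using sub[of ?b y] assms(3-6) by (metis semigroup_closed[OF assms(1)])
  qed (use sub assms(3,4) in blast)
  then show ?thesis
    using assms(2-4) unfolding R_trivial_def by (metis semigroup_closed[OF assms(1)])
qed

lemma R_trivial_drop_last:
  fixes S :: "'a magma"
  assumes sg: "is_semigroup S" and R: "R_trivial S" and fin: "finite (carrier S)"
    and N: "card (carrier S) < N" and p: "0 < p"
    and blocks: "\<And>k l. k < N \<Longrightarrow> \<exists>i. k * p \<le> i \<and> i < Suc k * p \<and> f i = f l"
  shows "satisfies S (map f [0..<Suc (N * p)], map f [0..<N * p])"
  unfolding satisfies_def
proof (intro allI impI)
  fix \<phi> :: "nat \<Rightarrow> 'a" assume \<phi>: "\<forall>x. \<phi> x \<in> carrier S"
  define pv where "pv m = word_value S \<phi> (map f [0..<m])" for m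
  have pv_in: "pv m \<in> carrier S" if "0 < m" for m
    unfolding pv_def using word_value_closed[OF sg] \<phi> that by simp
  have pv_Suc: "pv (Suc m) = pv m \<cdot>\<^bsub>S\<^esub> \<phi> (f m)" if "0 < m" for m
    unfolding pv_def using word_value_append[OF sg, of \<phi> "map f [0..<m]" "[f m]"] \<phi> that by simp
  have pv_split: "\<exists>y\<in>carrier S. pv m' = pv m \<cdot>\<^bsub>S\<^esub> y" if "0 < m" "m < m'" for m m'
  proof -
    have "[0..<m'] = [0..<m] @ [m..<m']" using that upt_add_eq_append[of 0 m "m' - m"] by simp
    then have "pv m' = pv m \<cdot>\<^bsub>S\<^esub> word_value S \<phi> (map f [m..<m'])"
      unfolding pv_def
      using word_value_append[OF sg, of \<phi> "map f [0..<m]" "map f [m..<m']"] \<phi> that by simp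
    moreover have "word_value S \<phi> (map f [m..<m']) \<in> carrier S"
      using word_value_closed[OF sg] \<phi> that by simp
    ultimately show ?thesis by blast
  qed
  \<comment> \<open>There are more block ends than elements of \<open>S\<close>, so the prefixes up
    to the ends of two blocks \<open>i < j\<close> have the same value \<open>e\<close>.\<close>
  have "(\<lambda>k. pv (Suc k * p)) ` {..<N} \<subseteq> carrier S" using pv_in p by auto
  then have "card ((\<lambda>k. pv (Suc k * p)) ` {..<N}) < card {..<N}"
    using N card_mono[OF fin] by (metis card_lessThan le_less_trans)
  then have "\<not> inj_on (\<lambda>k. pv (Suc k * p)) {..<N}" by (rule pigeonhole)
  then obtain i j where ij: "i < j" "j < N" "pv (Suc i * p) = pv (Suc j * p)"
    unfolding inj_on_def by (metis lessThan_iff linorder_neqE_nat)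
  define e where "e = pv (Suc i * p)"
  have pos: "0 < Suc i * p" using p by simp
  have e_in: "e \<in> carrier S" using pv_in[OF pos] by (simp add: e_def)
  \<comment> \<open>A prefix value between the two ends is a right multiple of \<open>e\<close> and
    has \<open>e\<close> as a right multiple.\<close>
  have pv_e: "pv m = e" if "Suc i * p \<le> m" "m \<le> Suc j * p" for m
  proof (cases "m = Suc i * p \<or> m = Suc j * p")
    case True
    then show ?thesis using ij(3) by (auto simp: e_def)
  next
    case False
    with that have "Suc i * p < m" "m < Suc j * p" by auto
    with pos obtain x y where "x \<in> carrier S" "pv m = e \<cdot>\<^bsub>S\<^esub> x"
      "y \<in> carrier S" "e = pv m \<cdot>\<^bsub>S\<^esub> y"
      using pv_split[of "Suc i * p" m] pv_split[of m "Suc j * p"] ij(3)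
      unfolding e_def by (metis less_trans)
    then show ?thesis using R_trivial_absorb[OF sg R e_in] by metis
  qed
  \<comment> \<open>As \<open>i < j\<close>, block \<open>Suc i\<close> lies in the constant
    stretch, and it contains the letter \<open>f l\<close>.\<close>
  have fixed: "e \<cdot>\<^bsub>S\<^esub> \<phi> (f l) = e" for l
  proof -
    obtain m where m: "Suc i * p \<le> m" "m < Suc (Suc i) * p" "f m = f l"
      using blocks[of "Suc i" l] ij by auto
    have "Suc (Suc i) * p \<le> Suc j * p" using ij(1) by (intro mult_le_mono1) simp
    with m(2) have "m < Suc j * p" by simp
    then show ?thesis using pv_Suc[of m] pv_e[of m] pv_e[of "Suc m"] m pos by simp
  qed
  have stable: "pv m = e" if "Suc i * p \<le> m" for m
    using that
  proof (induction m rule: dec_induct)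
    case base
    then show ?case by (simp add: e_def)
  next
    case (step m)
    have "0 < m" using less_le_trans[OF pos step(1)] .
    with step show ?case using pv_Suc[of m] fixed by simp
  qed
  have "Suc i * p \<le> N * p" using ij by (intro mult_le_mono1) simp
  then have "pv (Suc (N * p)) = pv (N * p)" using stable by simp
  then show "word_value S \<phi> (fst (map f [0..<Suc (N * p)], map f [0..<N * p])) =
      word_value S \<phi> (snd (map f [0..<Suc (N * p)], map f [0..<N * p]))"
    by (simp add: pv_def)
qed

section \<open>The contradiction from a finite basis\<close>

theorem theorem3p1:
  fixes S :: "'b magma"
  assumes "is_semigroup S"
    and "finite (carrier S)"
    and "R_trivial S"
    and "IC 4 \<in> var S"
    and "infinite (UNIV :: 'a set)"
  shows "\<not> finitely_based (var S :: 'a magma set)"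
proof
  assume "finitely_based (var S :: 'a magma set)"
  then obtain \<Sigma> where \<Sigma>: "\<Sigma> \<subseteq> identities" "finite \<Sigma>" "(var S :: 'a magma set) = variety \<Sigma>"
    unfolding finitely_based_def by blast
  have IC: "is_semigroup (IC 4)" "\<And>e. e \<in> identities \<Longrightarrow> satisfies S e \<Longrightarrow> satisfies (IC 4) e"
    using assms(4) by (auto simp: var_def variety_def)
  \<comment> \<open>\<open>\<Sigma>\<close> describes the variety only for semigroups on
    \<open>'a\<close>, so its validity in \<open>IC 4\<close> is obtained through a copy on
    \<open>'a\<close>.\<close>
  obtain I :: "'a magma" where I: "is_semigroup I"
    "\<And>e. e \<in> identities \<Longrightarrow> satisfies I e \<longleftrightarrow> satisfies (IC 4) e"
    using finite_semigroup_copy[OF IC(1) finite_carrier_IC assms(5)] by blast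
  have "I \<in> var S" using I IC(2) by (simp add: var_def variety_def)
  then have "satisfies I e" if "e \<in> \<Sigma>" for e
    using that \<Sigma>(3) by (simp add: variety_def)
  then have IC_\<Sigma>: "satisfies (IC 4) e" if "e \<in> \<Sigma>" for e
    using that \<Sigma>(1) I(2) by blast
  define n where "n = Suc (\<Sum>e\<in>\<Sigma>. card (set (fst e)) + card (set (snd e)))"
  have few: "card (set (fst e)) < n" "card (set (snd e)) < n" if "e \<in> \<Sigma>" for e
    using member_le_sum[OF that _ \<Sigma>(2), of "\<lambda>e. card (set (fst e)) + card (set (snd e))"]
    by (auto simp: n_def)
  define N where "N = Suc (card (carrier S))"
  obtain p where p: "prime p" "N * n + N + 1 < p" using bigger_prime by blast
  have "N * p > 0" using p(2) by (simp add: N_def)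
  define U where "U = map (letter p) [0..<Suc (N * p)]"
  define V where "V = map (letter p) [0..<N * p]"
  have UV: "U = V @ [letter p (N * p)]" by (simp add: U_def V_def)
  have V_ne: "V \<noteq> []" using \<open>N * p > 0\<close> by (simp add: V_def)
  have S_UV: "satisfies S (U, V)"
    unfolding U_def V_def
  proof (rule R_trivial_drop_last)
    fix k l assume "k < N"
    then show "\<exists>i. k * p \<le> i \<and> i < Suc k * p \<and> letter p i = letter p l"
      using letter_surj_on_block[OF p(1), of k "letter p l"] p(2) by (simp add: letter_def)
  qed (use assms p(2) in \<open>auto simp: N_def\<close>)
  have "satisfies (factor_semigroup U) e" if e: "e \<in> \<Sigma>" for e
  proof -
    obtain u v where uv: "e = (u, v)" "u \<noteq> []" "v \<noteq> []"
      using e \<Sigma>(1) by (auto simp: identities_def)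
    have nth: "U ! i = letter p i" if "i < Suc (N * p)" for i
      using that by (simp add: U_def del: upt_Suc)
    have len: "length U = Suc (N * p)" by (simp add: U_def)
    show ?thesis
      unfolding uv(1)
    proof (rule factor_semigroup_satisfies[OF _ _ IC(1)])
      show "i = j" if "Suc i < length U" "Suc j < length U" "U ! i = U ! j"
        "U ! Suc i = U ! Suc j" for i j
        using letter_pair[OF p(1), of N i j] that p(2) by (simp add: nth len)
      show "U ! i \<noteq> U ! j" if "i < j" "j < length U" "j - i < n" for i j
        using letter_window[of i j n N p] that p(2) by (simp add: nth len)
    qed (use uv few[OF e] IC_\<Sigma>[OF e] in auto)
  qed
  \<comment> \<open>Since the factor semigroup satisfies \<open>\<Sigma>\<close>, its copy on
    \<open>'a\<close> lies in \<open>var S\<close> and inherits \<open>U \<approx> V\<close> from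
    \<open>S\<close>.\<close>
  moreover obtain M :: "'a magma" where M: "is_semigroup M"
    "\<And>e. e \<in> identities \<Longrightarrow> satisfies M e \<longleftrightarrow> satisfies (factor_semigroup U) e"
    using finite_semigroup_copy[OF is_semigroup_factor_semigroup finite_factor_semigroup assms(5)]
    by blast
  ultimately have "satisfies M e" if "e \<in> \<Sigma>" for e
    using that \<Sigma>(1) by blast
  then have "M \<in> var S" using M(1) \<Sigma>(3) by (simp add: variety_def)
  moreover have UV_id: "(U, V) \<in> identities" using UV V_ne by (simp add: identities_def)
  ultimately have "satisfies M (U, V)"
    using S_UV unfolding var_def variety_def by blast
  then have sat: "satisfies (factor_semigroup U) (U, V)" using M(2) UV_id by simp
  \<comment> \<open>For a letter \<open>x\<close> outside \<open>U\<close> the word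
    \<open>[x]\<close> is not a factor, so \<open>x\<close> is sent to zero.\<close>
  define \<phi> where "\<phi> x = (if x \<in> set U then Some [x] else None)" for x
  have "\<phi> x \<in> carrier (factor_semigroup U)" for x
    by (auto simp: \<phi>_def factor_semigroup_def in_set_conv_decomp sublist_def)
  then have "word_value (factor_semigroup U) \<phi> U = word_value (factor_semigroup U) \<phi> V"
    using sat by (simp add: satisfies_def)
  moreover have "word_value (factor_semigroup U) \<phi> U = Some U"
    by (rule word_value_factor_semigroup_letters) (use UV in \<open>auto simp: \<phi>_def\<close>)
  moreover have "word_value (factor_semigroup U) \<phi> V = Some V"
    by (rule word_value_factor_semigroup_letters) (use UV V_ne in \<open>auto simp: \<phi>_def\<close>)
  ultimately show False using UV by simp
qed

end
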